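(* Let $\mathcal{T}=(Q,\Sigma,\delta)$ be an $S$-automaton, let $k\ge1$, let $u\in\Sigma^*$ and let $n=|Q^*\circ u|$. Then $u$ is $k$-expandable with respect to $\mathcal{T}$ if and only if it is $k$-expandable by some $x\in\Sigma^*$ with $$|x|<\left(\max\{2,|Q|\}\right)^{|\Sigma|\,(n+k)^2}\,2^{\binom{n+k}{2}}.$$
   Context: An alphabet is a non-empty finite set; $\Sigma^*$ is the set of finite words over $\Sigma$, including the empty word $\varepsilon$; $|x|$ is the length of a word $x$. An $S$-automaton is a triple $\mathcal{T}=(Q,\Sigma,\delta)$ with a finite set $Q$ of states, an alphabet $\Sigma$ and a transition set $\delta\subseteq Q\times\Sigma\times\Sigma\times Q$ that is deterministic: for all $q\in Q$, $a\in\Sigma$ there is at most one transition $(q,a,b,p)\in\delta$ (with $b\in\Sigma,p\in Q$). It need not be complete. A transition $(q,a,b,p)$ goes from $q$ to $p$, reads $a$ and outputs $b$. Each $q\in Q$ induces a partial length-preserving function $q\circ\colon\Sigma^*\to\Sigma^*$: $q\circ a_1\dots a_m=b_1\dots b_m$ if there is a run $q=q_0,q_1,\dots,q_m$ with $(q_{i-1},a_i,b_i,q_i)\in\delta$ for all $i$; it is undefined if no such run exists. For $\boldsymbol{q}=q_\ell\dots q_1\in Q^*$, $\boldsymbol{q}\circ$ is the composition of partial functions applying $q_1\circ$ first and $q_\ell\circ$ last; $\varepsilon\circ$ is the identity. The orbit of $u\in\Sigma^*$ is $Q^*\circ u=\{\boldsymbol{q}\circ u\mid \boldsymbol{q}\in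 Q^*,\ \boldsymbol{q}\circ\text{ defined on }u\}$. For $k\ge1$ and $x\in\Sigma^*$, the word $u$ is $k$-expandable by $x$ if $|Q^*\circ ux|-|Q^*\circ u|\ge k$; $u$ is $k$-expandable if it is $k$-expandable by some $x\in\Sigma^*$. *)

theory Defs
  imports Complex_Main
begin

locale S_automaton =
  fixes Q :: "'q set" and \<Sigma> :: "'a set" and \<delta> :: "('q \<times> 'a \<times> 'a \<times> 'q) set"
  assumes finite_states: "finite Q"
    and finite_alphabet: "finite \<Sigma>"
    and alphabet_nonempty: "\<Sigma> \<noteq> {}"
    and transitions: "\<delta> \<subseteq> Q \<times> \<Sigma> \<times> \<Sigma> \<times> Q"
    and deterministic: "\<lbrakk>(q, a, b, p) \<in> \<delta>; (q, a, b', p') \<in> \<delta>\<rbrakk> \<Longrightarrow> b = b' \<and> p = p'"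

inductive run :: "('q \<times> 'a \<times> 'a \<times> 'q) set \<Rightarrow> 'q \<Rightarrow> 'a list \<Rightarrow> 'a list \<Rightarrow> 'q \<Rightarrow> bool"
  for \<delta> where
  run_Nil: "run \<delta> q [] [] q"
| run_Cons: "\<lbrakk>(q, a, b, p) \<in> \<delta>; run \<delta> p u v r\<rbrakk> \<Longrightarrow> run \<delta> q (a # u) (b # v) r"

text \<open>The output word chosen by \<open>THE\<close> is unique when the automaton is deterministic.\<close>

definition state_act :: "('q \<times> 'a \<times> 'a \<times> 'q) set \<Rightarrow> 'q \<Rightarrow> 'a list \<rightharpoonup> 'a list" where
  "state_act \<delta> q u =
     (if \<exists>v p. run \<delta> q u v p then Some (THE v. \<exists>p. run \<delta> q u v p) else None)"

text \<open>The list \<open>[q\<^sub>l, \<dots>, q\<^sub>1]\<close> represents the state sequence \<open>q\<^sub>l \<dots> q\<^sub>1\<close>, so its last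
  entry acts first.\<close>

fun seq_act :: "('q \<times> 'a \<times> 'a \<times> 'q) set \<Rightarrow> 'q list \<Rightarrow> 'a list \<rightharpoonup> 'a list" where
  "seq_act \<delta> [] = Some"
| "seq_act \<delta> (q # qs) = state_act \<delta> q \<circ>\<^sub>m seq_act \<delta> qs"

definition orbit :: "'q set \<Rightarrow> ('q \<times> 'a \<times> 'a \<times> 'q) set \<Rightarrow> 'a list \<Rightarrow> 'a list set" where
  "orbit Q \<delta> u = {v. \<exists>qs \<in> lists Q. seq_act \<delta> qs u = Some v}"

text \<open>The difference is taken in the integers: since the automaton need not be complete,
  the orbit of \<open>u @ x\<close> may be smaller than that of \<open>u\<close>.\<close>

definition expandable_by ::
  "'q set \<Rightarrow> ('q \<times> 'a \<times> 'a \<times> 'q) set \<Rightarrow> nat \<Rightarrow> 'a list \<Rightarrow> 'a list \<Rightarrow> bool" where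
  "expandable_by Q \<delta> k u x \<longleftrightarrow>
     int (card (orbit Q \<delta> (u @ x))) - int (card (orbit Q \<delta> u)) \<ge> int k"

definition expandable ::
  "'q set \<Rightarrow> 'a set \<Rightarrow> ('q \<times> 'a \<times> 'a \<times> 'q) set \<Rightarrow> nat \<Rightarrow> 'a list \<Rightarrow> bool" where
  "expandable Q \<Sigma> \<delta> k u \<longleftrightarrow> (\<exists>x \<in> lists \<Sigma>. expandable_by Q \<delta> k u x)"

end

theory Submission
  imports Defs "HOL-Library.FuncSet"
begin

text \<open>
  Let \<open>x\<close> be a shortest word expanding \<open>u\<close> and put \<open>N = n + k\<close>. Dropping the last letter of \<open>x\<close>
  leaves an orbit of size less than \<open>N\<close>, so the orbit of \<open>u @ x\<close> has at most \<open>|\<Sigma>| N\<close> elements, and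
  each of them is reached by a state sequence shorter than that. Choose \<open>N\<close> elements and such a
  sequence for each. While reading \<open>x\<close>, record the tuple of current state sequences together with
  the set of pairs whose outputs already differ. If \<open>x\<close> were as long as the claimed bound, such a
  configuration would repeat, and cutting out the factor in between would yield a shorter word
  with still \<open>N\<close> distinct outputs.
\<close>

text \<open>The \<open>m + 1\<close> indices \<open>0..m\<close> share at most \<open>m\<close>
  values. It serves twice: to cut a loop out of a state sequence, and to cut a factor out of an
  input word.\<close>

lemma pigeonhole_sequence:
  fixes c :: "nat \<Rightarrow> 'c"
  assumes "finite C" "\<And>i. i \<le> m \<Longrightarrow> c i \<in> C" "card C \<le> m"
  obtains i j where "i < j" "j \<le> m" "c i = c j"
proof -
  have "\<not> inj_on c {..m}"
    using card_inj_on_le[of c "{..m}" C] assms by force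
  then obtain i j where "i \<le> m" "j \<le> m" "i \<noteq> j" "c i = c j"
    by (auto simp: inj_on_def)
  then show thesis
    using that by (metis linorder_neqE_nat)
qed

section \<open>Runs of single states and of state sequences\<close>

lemma run_append:
  "run \<delta> q (u @ x) w r \<longleftrightarrow> (\<exists>v y p. w = v @ y \<and> run \<delta> q u v p \<and> run \<delta> p x y r)"
proof (induction u arbitrary: q w)
  case Nil
  show ?case by (auto intro: run_Nil elim: run.cases)
next
  case (Cons a u)
  have Cons_iff: "run \<delta> q (a # z) w r \<longleftrightarrow> (\<exists>b p v. w = b # v \<and> (q, a, b, p) \<in> \<delta> \<and> run \<delta> p z v r)"
    for q z w r
    by (subst run.simps) auto
  show ?case
    unfolding append_Cons Cons_iff Cons.IH by (metis append_Cons)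
qed

lemma run_length: "run \<delta> q u v p \<Longrightarrow> length v = length u"
  by (induction rule: run.induct) auto

text \<open>Runs in the composed automaton, whose states are state sequences. Unlike
  \<open>seq_act\<close> it also keeps the sequence \<open>ps\<close> that is reached, in the same
  order as \<open>qs\<close>, so that \<open>ps\<close> can go on reading the rest of the
  input.\<close>

fun seq_run :: "('q \<times> 'a \<times> 'a \<times> 'q) set \<Rightarrow> 'q list \<Rightarrow> 'a list \<Rightarrow> 'a list \<Rightarrow> 'q list \<Rightarrow> bool" where
  "seq_run \<delta> [] u v ps \<longleftrightarrow> v = u \<and> ps = []"
| "seq_run \<delta> (q # qs) u v ps \<longleftrightarrow>
     (\<exists>w p ps'. seq_run \<delta> qs u w ps' \<and> run \<delta> q w v p \<and> ps = p # ps')"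

lemma seq_run_length: "seq_run \<delta> qs u v ps \<Longrightarrow> length v = length u \<and> length ps = length qs"
  by (induction qs arbitrary: v ps) (auto dest: run_length)

lemma seq_run_append:
  "seq_run \<delta> qs (u @ x) w rs \<longleftrightarrow>
     (\<exists>v y ps. w = v @ y \<and> seq_run \<delta> qs u v ps \<and> seq_run \<delta> ps x y rs)"
proof (induction qs arbitrary: w rs)
  case Nil
  show ?case by auto
next
  case (Cons q qs)
  show ?case (is "?L \<longleftrightarrow> ?R")
  proof
    assume ?L
    then obtain v y ps rs' r where "seq_run \<delta> qs u v ps" "seq_run \<delta> ps x y rs'"
      "run \<delta> q (v @ y) w r" "rs = r # rs'"
      by (auto simp: Cons.IH)
    then show ?R
      unfolding run_append by fastforce
  next
    assume ?R
    then show ?L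
      by (fastforce simp: Cons.IH run_append)
  qed
qed

lemma seq_run_append_take:
  assumes "seq_run \<delta> qs (u @ x) w rs"
  obtains ps where "seq_run \<delta> qs u (take (length u) w) ps"
    "seq_run \<delta> ps x (drop (length u) w) rs"
proof -
  from assms obtain v y ps where *: "w = v @ y" "seq_run \<delta> qs u v ps" "seq_run \<delta> ps x y rs"
    unfolding seq_run_append by auto
  then show thesis
    using that seq_run_length[OF *(2)] by simp
qed

lemma seq_act_append: "seq_act \<delta> (ps @ qs) = seq_act \<delta> ps \<circ>\<^sub>m seq_act \<delta> qs"
  by (induction ps) (auto simp: map_comp_def fun_eq_iff split: option.splits)

section \<open>Determinism and closure\<close>

context S_automaton
begin

lemma run_unique: "run \<delta> q u v p \<Longrightarrow> run \<delta> q u v' p' \<Longrightarrow> v' = v \<and> p' = p"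
proof (induction arbitrary: v' p' rule: run.induct)
  case (run_Nil q)
  then show ?case by (auto elim: run.cases)
next
  case (run_Cons q a b p u v r)
  from run_Cons.prems obtain b' s w where "v' = b' # w" "(q, a, b', s) \<in> \<delta>" "run \<delta> s u w p'"
    by (auto elim: run.cases)
  then show ?case
    using run_Cons.IH run_Cons.hyps(1) deterministic by blast
qed

lemma run_closed: "run \<delta> q u v p \<Longrightarrow> q \<in> Q \<Longrightarrow> p \<in> Q \<and> v \<in> lists \<Sigma>"
  by (induction rule: run.induct) (use transitions in auto)

lemma state_act_eq_Some: "state_act \<delta> q u = Some v \<longleftrightarrow> (\<exists>p. run \<delta> q u v p)"
proof -
  have "(THE v. \<exists>p. run \<delta> q u v p) = w" if "run \<delta> q u w p" for w p
    using that run_unique by blast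
  then show ?thesis
    by (auto simp: state_act_def)
qed

lemma seq_act_eq_Some: "seq_act \<delta> qs u = Some v \<longleftrightarrow> (\<exists>ps. seq_run \<delta> qs u v ps)"
proof (induction qs arbitrary: v)
  case (Cons q qs)
  then show ?case
    by (auto simp: map_comp_Some_iff state_act_eq_Some)
qed auto

lemma seq_run_closed:
  "seq_run \<delta> qs u v ps \<Longrightarrow> qs \<in> lists Q \<Longrightarrow> u \<in> lists \<Sigma> \<Longrightarrow> ps \<in> lists Q \<and> v \<in> lists \<Sigma>"
proof (induction qs arbitrary: v ps)
  case (Cons q qs)
  then obtain w p ps' where *: "seq_run \<delta> qs u w ps'" "run \<delta> q w v p" "ps = p # ps'"
    by auto
  then show ?case
    using Cons.IH[OF *(1)] Cons.prems run_closed[OF *(2)] by auto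
qed auto

lemma mem_orbit: "v \<in> orbit Q \<delta> u \<longleftrightarrow> (\<exists>qs \<in> lists Q. \<exists>ps. seq_run \<delta> qs u v ps)"
  by (simp add: orbit_def seq_act_eq_Some)

section \<open>Size of orbits and length of sequences reaching their elements\<close>

lemma finite_orbit:
  assumes "u \<in> lists \<Sigma>"
  shows "finite (orbit Q \<delta> u)"
proof (rule finite_subset)
  show "orbit Q \<delta> u \<subseteq> {v. set v \<subseteq> \<Sigma> \<and> length v = length u}"
    using assms seq_run_closed seq_run_length by (fastforce simp: mem_orbit)
  show "finite {v. set v \<subseteq> \<Sigma> \<and> length v = length u}"
    using finite_alphabet by (rule finite_lists_length_eq)
qed

text \<open>Removing the last letter of an output on \<open>u @ [a]\<close> leaves an element of the
  orbit of \<open>u\<close>, and at most \<open>card \<Sigma>\<close> letters can have been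
  removed.\<close>

lemma card_orbit_snoc_le:
  assumes "u \<in> lists \<Sigma>" "a \<in> \<Sigma>"
  shows "card (orbit Q \<delta> (u @ [a])) \<le> card (orbit Q \<delta> u) * card \<Sigma>"
proof -
  have "orbit Q \<delta> (u @ [a]) \<subseteq> (\<lambda>(v, b). v @ [b]) ` (orbit Q \<delta> u \<times> \<Sigma>)"
  proof
    fix w assume "w \<in> orbit Q \<delta> (u @ [a])"
    then obtain qs rs where qs: "qs \<in> lists Q" "seq_run \<delta> qs (u @ [a]) w rs"
      by (auto simp: mem_orbit)
    then obtain v y ps where *: "w = v @ y" "seq_run \<delta> qs u v ps" "seq_run \<delta> ps [a] y rs"
      unfolding seq_run_append by auto
    have "ps \<in> lists Q"
      using seq_run_closed[OF *(2)] qs assms by auto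
    then have "y \<in> lists \<Sigma>" "length y = 1"
      using seq_run_closed[OF *(3)] seq_run_length[OF *(3)] assms by auto
    then obtain b where "y = [b]" "b \<in> \<Sigma>"
      by (auto simp: length_Suc_conv)
    then show "w \<in> (\<lambda>(v, b). v @ [b]) ` (orbit Q \<delta> u \<times> \<Sigma>)"
      using * qs by (intro image_eqI[of _ _ "(v, b)"]) (auto simp: mem_orbit)
  qed
  moreover have "finite (orbit Q \<delta> u \<times> \<Sigma>)"
    using finite_orbit[OF assms(1)] finite_alphabet by simp
  ultimately show ?thesis
    by (metis surj_card_le card_cartesian_product)
qed

text \<open>Along a shortest sequence from \<open>u\<close> to \<open>v\<close> no intermediate word
  repeats, since the loop could be cut out. A sequence of length \<open>m\<close> passes through
  \<open>m + 1\<close> words, counting \<open>u\<close> itself, hence the strict bound.\<close>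

lemma orbit_short_sequence:
  assumes u: "u \<in> lists \<Sigma>" and v: "v \<in> orbit Q \<delta> u"
  obtains qs where "qs \<in> lists Q" "seq_act \<delta> qs u = Some v" "length qs < card (orbit Q \<delta> u)"
proof -
  define P where "P qs \<longleftrightarrow> qs \<in> lists Q \<and> seq_act \<delta> qs u = Some v" for qs
  have "\<exists>qs. P qs"
    using v by (auto simp: P_def orbit_def)
  then obtain qs where qs: "P qs" and minimal: "\<And>ps. P ps \<Longrightarrow> length qs \<le> length ps"
    by (metis ex_has_least_nat)
  have split: "seq_act \<delta> (take i qs @ drop i qs) u = Some v" for i
    using qs by (simp add: P_def)
  have "length qs < card (orbit Q \<delta> u)"
  proof (rule ccontr)
    assume long: "\<not> ?thesis"
    \<comment> \<open>The last entry acts first, so the suffixes of \<open>qs\<close> yield the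
      intermediate words. Each is defined on \<open>u\<close> because \<open>qs\<close> is, so
      \<open>the\<close> is never applied to \<open>None\<close>.\<close>
    have "the (seq_act \<delta> (drop i qs) u) \<in> orbit Q \<delta> u" for i
    proof -
      obtain w where "seq_act \<delta> (drop i qs) u = Some w"
        using split[of i] unfolding seq_act_append by (auto simp: map_comp_Some_iff)
      moreover have "drop i qs \<in> lists Q"
        using qs by (auto simp: P_def dest: in_set_dropD)
      ultimately show ?thesis
        unfolding orbit_def by auto
    qed
    then obtain i j where ij: "i < j" "j \<le> length qs"
      and eq: "the (seq_act \<delta> (drop i qs) u) = the (seq_act \<delta> (drop j qs) u)"
      using pigeonhole_sequence[OF finite_orbit[OF u], of "length qs" "\<lambda>i. the (seq_act \<delta> (drop i qs) u)"]
        long by auto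
    have "seq_act \<delta> (take i qs @ drop j qs) u = Some v"
      using split[of i] split[of j] eq unfolding seq_act_append
      by (auto simp: map_comp_Some_iff)
    then have "P (take i qs @ drop j qs)"
      using qs by (auto simp: P_def dest: in_set_takeD in_set_dropD)
    from minimal[OF this] ij show False
      by simp
  qed
  then show thesis
    using that qs by (auto simp: P_def)
qed

section \<open>Cutting a factor out of a long input\<close>

lemma shorten_expansion:
  fixes L N :: nat
  assumes u: "u \<in> lists \<Sigma>" and x: "x \<in> lists \<Sigma>"
    and V: "finite V" "card V = N"
    and short: "\<And>v. v \<in> V \<Longrightarrow>
      \<exists>qs \<in> lists Q. length qs \<le> L \<and> seq_act \<delta> qs (u @ x) = Some v"
    and long: "(max 2 (card Q)) ^ (N * L) * 2 ^ (N choose 2) \<le> length x"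
  obtains y where "y \<in> lists \<Sigma>" "length y < length x" "N \<le> card (orbit Q \<delta> (u @ y))"
proof -
  let ?M = "max 2 (card Q)"
  obtain s where s: "\<And>v. v \<in> V \<Longrightarrow> s v \<in> lists Q \<and> length (s v) \<le> L \<and>
      seq_act \<delta> (s v) (u @ x) = Some v"
    using short by metis
  then obtain r where r: "\<And>v. v \<in> V \<Longrightarrow> seq_run \<delta> (s v) (u @ x) v (r v)"
    unfolding seq_act_eq_Some by metis
  define l where "l i = length u + i" for i
  \<comment> \<open>The sequence \<open>ps\<close> is what \<open>s v\<close> has become after
    reading \<open>u\<close> and \<open>i\<close> letters of \<open>x\<close>. The premises stand
    under the quantifier so that one choice function \<open>p\<close> of \<open>v\<close> and
    \<open>i\<close> results.\<close>
  have "\<exists>ps. v \<in> V \<longrightarrow> i \<le> length x \<longrightarrow>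
      seq_run \<delta> (s v) (u @ take i x) (take (l i) v) ps \<and>
      seq_run \<delta> ps (drop i x) (drop (l i) v) (r v)" for v i
  proof (cases "v \<in> V \<and> i \<le> length x")
    case True
    then have "seq_run \<delta> (s v) ((u @ take i x) @ drop i x) v (r v)"
      using r by simp
    then show ?thesis
      by (rule seq_run_append_take) (use True in \<open>auto simp: l_def\<close>)
  qed auto
  then obtain p where p: "\<And>v i. v \<in> V \<Longrightarrow> i \<le> length x \<Longrightarrow>
      seq_run \<delta> (s v) (u @ take i x) (take (l i) v) (p v i) \<and>
      seq_run \<delta> (p v i) (drop i x) (drop (l i) v) (r v)"
    by metis
  \<comment> \<open>Reading letters changes the entries of a state sequence but not their number, so
    coordinate \<open>v\<close> keeps the length of \<open>s v\<close>.\<close>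
  define S where "S = (\<Pi>\<^sub>E v\<in>V. {qs. set qs \<subseteq> Q \<and> length qs = length (s v)})"
  define E where "E = {A. A \<subseteq> V \<and> card A = 2}"
  \<comment> \<open>The pairs from \<open>V\<close> whose outputs already differ within the first
    \<open>l i\<close> letters.\<close>
  define D where "D i = {A \<in> E. inj_on (take (l i)) A}" for i
  define c where "c i = (restrict (\<lambda>v. p v i) V, D i)" for i
  have "finite S"
    unfolding S_def using V finite_states by (intro finite_PiE finite_lists_length_eq) auto
  have "finite E"
    unfolding E_def using V by simp
  have mem: "c i \<in> S \<times> Pow E" if "i \<le> length x" for i
  proof -
    have "p v i \<in> {qs. set qs \<subseteq> Q \<and> length qs = length (s v)}" if "v \<in> V" for v
    proof -
      note run = conjunct1[OF p[OF \<open>v \<in> V\<close> \<open>i \<le> length x\<close>]]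
      have "u @ take i x \<in> lists \<Sigma>"
        using u x by (auto dest: in_set_takeD)
      then show ?thesis
        using seq_run_closed[OF run] seq_run_length[OF run] s[OF \<open>v \<in> V\<close>] by auto
    qed
    then show ?thesis
      by (auto simp: c_def S_def D_def)
  qed
  have "card S = (\<Prod>v\<in>V. card Q ^ length (s v))"
    unfolding S_def using V finite_states by (simp add: card_PiE card_lists_length_eq)
  also have "\<dots> \<le> (\<Prod>v\<in>V. ?M ^ L)"
  proof (rule prod_mono)
    fix v assume "v \<in> V"
    have "card Q ^ length (s v) \<le> ?M ^ length (s v)"
      by (rule power_mono) auto
    \<comment> \<open>Raising the exponent needs a base of at least 1, whereas \<open>card Q\<close>
      may be 0.\<close>
    also have "\<dots> \<le> ?M ^ L"
      using s[OF \<open>v \<in> V\<close>] by (intro power_increasing) auto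
    finally show "0 \<le> card Q ^ length (s v) \<and> card Q ^ length (s v) \<le> ?M ^ L"
      by simp
  qed
  also have "\<dots> = ?M ^ (N * L)"
    using V by (simp flip: power_mult add: mult.commute)
  finally have "card S \<le> ?M ^ (N * L)" .
  moreover have "card (Pow E) = 2 ^ (N choose 2)"
    using V \<open>finite E\<close> n_subsets[of V 2] by (simp add: card_Pow E_def)
  ultimately have "card (S \<times> Pow E) \<le> length x"
    using long by (simp add: card_cartesian_product) (meson le_trans mult_le_mono1)
  then obtain i j where ij: "i < j" "j \<le> length x" "c i = c j"
    using pigeonhole_sequence[of "S \<times> Pow E" "length x" c] mem \<open>finite S\<close> \<open>finite E\<close> by auto
  define y where "y = take i x @ drop j x"
  \<comment> \<open>The output of \<open>s v\<close> on \<open>u @ y\<close>: since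
    \<open>p v i = p v j\<close>, the part after position \<open>j\<close> can be run directly from
    position \<open>i\<close>.\<close>
  define f where "f v = take (l i) v @ drop (l j) v" for v :: "'a list"
  have y: "y \<in> lists \<Sigma>"
    using x by (auto simp: y_def dest: in_set_takeD in_set_dropD)
  have "f ` V \<subseteq> orbit Q \<delta> (u @ y)"
  proof
    fix w assume "w \<in> f ` V"
    then obtain v where v: "v \<in> V" "w = f v"
      by auto
    have "p v i = p v j"
      using ij(3) v by (auto simp: c_def restrict_def fun_eq_iff split: if_splits)
    then have "seq_run \<delta> (s v) ((u @ take i x) @ drop j x) (f v) (r v)"
      unfolding seq_run_append[of _ _ "u @ take i x"] f_def
      using p[of v i] p[of v j] v ij by auto
    then show "w \<in> orbit Q \<delta> (u @ y)"
      using v s by (auto simp: mem_orbit y_def)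
  qed
  moreover have "inj_on f V"
  proof (rule inj_onI, rule ccontr)
    \<comment> \<open>If \<open>f v = f w\<close>, the outputs agree up to \<open>l i\<close> and
      beyond \<open>l j\<close>. Then \<open>{v, w}\<close> is not in \<open>D i = D j\<close>, so
      they also agree up to \<open>l j\<close>, forcing \<open>v = w\<close>.\<close>
    fix v w assume vw: "v \<in> V" "w \<in> V" "f v = f w" "v \<noteq> w"
    have len: "length v = length (u @ x)" "length w = length (u @ x)"
      using seq_run_length r vw by blast+
    then have "length (take (l i) v) = length (take (l i) w)"
      by simp
    then have eq: "take (l i) v = take (l i) w" "drop (l j) v = drop (l j) w"
      using vw(3) by (auto simp: f_def)
    then have "{v, w} \<notin> D i"
      using vw by (auto simp: D_def)
    then have "{v, w} \<notin> D j"
      using ij(3) by (simp add: c_def)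
    then have "take (l j) v = take (l j) w"
      using vw by (auto simp: D_def E_def inj_on_def)
    then show False
      using eq vw(4) by (metis append_take_drop_id)
  qed
  moreover have "finite (orbit Q \<delta> (u @ y))"
    using u y by (intro finite_orbit) auto
  ultimately have "N \<le> card (orbit Q \<delta> (u @ y))"
    using card_inj_on_le V(2) by blast
  moreover have "length y < length x"
    using ij by (simp add: y_def)
  ultimately show thesis
    using that y by blast
qed

end

section \<open>The length of a shortest expanding word\<close>

theorem corollary3p3:
  fixes Q :: "'q set" and \<Sigma> :: "'a set" and \<delta> :: "('q \<times> 'a \<times> 'a \<times> 'q) set"
    and k n :: nat and u :: "'a list"
  assumes "S_automaton Q \<Sigma> \<delta>"
    and "k \<ge> 1"
    and "u \<in> lists \<Sigma>"
    and "n = card (orbit Q \<delta> u)"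
  shows "expandable Q \<Sigma> \<delta> k u \<longleftrightarrow>
    (\<exists>x \<in> lists \<Sigma>. expandable_by Q \<delta> k u x \<and>
       length x < (max 2 (card Q)) ^ (card \<Sigma> * (n + k)\<^sup>2) * 2 ^ ((n + k) choose 2))"
    (is "_ \<longleftrightarrow> (\<exists>x \<in> lists \<Sigma>. _ \<and> length x < ?B)")
proof
  interpret S_automaton Q \<Sigma> \<delta> by fact
  let ?N = "n + k"
  have expands: "expandable_by Q \<delta> k u x \<longleftrightarrow> ?N \<le> card (orbit Q \<delta> (u @ x))" for x
    using assms(4) by (auto simp: expandable_by_def)
  define P where "P x \<longleftrightarrow> x \<in> lists \<Sigma> \<and> ?N \<le> card (orbit Q \<delta> (u @ x))" for x
  assume "expandable Q \<Sigma> \<delta> k u"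
  then have "\<exists>x. P x"
    by (auto simp: expandable_def expands P_def)
  then obtain x where x: "P x" and minimal: "\<And>y. P y \<Longrightarrow> length x \<le> length y"
    by (metis ex_has_least_nat)
  \<comment> \<open>The empty word gives an orbit of size \<open>n < n + k\<close>, as
    \<open>k\<close> is positive.\<close>
  have "x \<noteq> []"
    using x assms(2,4) by (auto simp: P_def)
  then obtain x' a where xa: "x = x' @ [a]"
    by (metis rev_exhaust)
  have words: "u @ x' \<in> lists \<Sigma>" "a \<in> \<Sigma>" "u @ x \<in> lists \<Sigma>"
    using x assms(3) by (auto simp: P_def xa)
  have "\<not> P x'"
    using minimal[of x'] by (auto simp: xa)
  then have "card (orbit Q \<delta> (u @ x')) \<le> ?N"
    using words by (auto simp: P_def)
  then have orbit_le: "card (orbit Q \<delta> (u @ x)) \<le> ?N * card \<Sigma>"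
    using card_orbit_snoc_le[OF words(1,2)] by (simp add: xa) (meson le_trans mult_le_mono1)
  \<comment> \<open>Tracking exactly \<open>n + k\<close> outputs, each by a sequence of length at
    most \<open>(n + k) * card \<Sigma>\<close>, produces the exponent
    \<open>card \<Sigma> * (n + k)\<^sup>2\<close>.\<close>
  obtain V where V: "V \<subseteq> orbit Q \<delta> (u @ x)" "card V = ?N" "finite V"
    using x obtain_subset_with_card_n by (metis P_def)
  have short: "\<exists>qs \<in> lists Q. length qs \<le> ?N * card \<Sigma> \<and> seq_act \<delta> qs (u @ x) = Some v"
    if "v \<in> V" for v
  proof -
    have "v \<in> orbit Q \<delta> (u @ x)"
      using that V by blast
    then obtain qs where "qs \<in> lists Q" "seq_act \<delta> qs (u @ x) = Some v"
      "length qs < card (orbit Q \<delta> (u @ x))"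
      by (rule orbit_short_sequence[OF words(3)])
    then show ?thesis
      using orbit_le by (intro bexI[of _ qs]) auto
  qed
  have "length x < ?B"
  proof (rule ccontr)
    assume "\<not> ?thesis"
    then have "(max 2 (card Q)) ^ (?N * (?N * card \<Sigma>)) * 2 ^ (?N choose 2) \<le> length x"
      by (simp add: power2_eq_square mult_ac)
    moreover have "x \<in> lists \<Sigma>"
      using x by (simp add: P_def)
    ultimately obtain y where "y \<in> lists \<Sigma>" "length y < length x" "?N \<le> card (orbit Q \<delta> (u @ y))"
      using shorten_expansion[OF assms(3) _ V(3,2) short] by blast
    then show False
      using minimal[of y] by (simp add: P_def)
  qed
  then show "\<exists>x \<in> lists \<Sigma>. expandable_by Q \<delta> k u x \<and> length x < ?B"
    using x expands by (auto simp: P_def)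
next
  assume "\<exists>x \<in> lists \<Sigma>. expandable_by Q \<delta> k u x \<and> length x < ?B"
  then show "expandable Q \<Sigma> \<delta> k u"
    by (auto simp: expandable_def)
qed

end
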